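(* Suppose $(P,Q,R)$ satisfies the system associated to the generalised Chazy equation with parameter $k=\frac23$: $$P'=\tfrac16(P^2-Q),\qquad Q'=\tfrac23(PQ-R),\qquad R'=PR+\tfrac1{80}Q^2.$$ Let $\omega=-\frac12+\frac{i\sqrt3}{2}$ and let $\mu$ be one of the following: \begin{align*} \mu=&-\frac{1}{240}\frac{Q^2}{R}+\frac{10^{1/3}}{30}\frac{Q}{R^{1/3}}-\frac{10^{2/3}}{15}R^{1/3},\quad\text{or}\\ &-\frac{1}{240}\frac{Q^2}{R}+\omega\frac{10^{1/3}}{30}\frac{Q}{R^{1/3}}-\omega^2\frac{10^{2/3}}{15}R^{1/3},\quad\text{or}\\ &-\frac{1}{240}\frac{Q^2}{R}+\omega^2\frac{10^{1/3}}{30}\frac{Q}{R^{1/3}}-\omega\frac{10^{2/3}}{15}R^{1/3}. \end{align*} Then the triple $$\left(P-\frac{1}{40}\frac{Q^2}{R}+2\mu,\;\;Q-\frac{Q^4}{640R^2}+10\mu^2,\;\;R-\frac{Q^3}{32R}-\frac{1}{51200}\frac{Q^6}{R^3}+\frac{5}{2}Q\mu-\frac{25}{6400}\frac{Q^4}{R^2}\mu+35\mu^3\right)$$ satisfies the same system, i.e. writing it as $(p,q,r)$: $p'=\frac16(p^2-q)$, $q'=\frac23(pq-r)$, $r'=pr+\frac1{80}q^2$.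
   Context: The first order system associated to the generalised Chazy equation with parameter $k$, for functions $P,Q,R$ of $x$ (with $'=d/dx$), is $P'=\frac16(P^2-Q)$, $Q'=\frac23(PQ-R)$, $R'=PR+\frac{k^2}{36-k^2}Q^2$. Here $R^{1/3}$ denotes one fixed differentiable branch of the cube root of $R$ (the same at each occurrence), $10^{1/3}$ is the real cube root with $10^{2/3}=(10^{1/3})^2$, and the statement is understood where $R\neq0$. *)

theory Defs
  imports "HOL-Analysis.Analysis"
begin

(* Derivatives are taken within S, so S may be an open subset of the complex plane
   (where "at x within S" is "at x") or a real interval regarded as a subset of it
   (where this is the derivative in the real variable). *)
definition gen_chazy_system ::
    "complex \<Rightarrow> complex set \<Rightarrow> (complex \<Rightarrow> complex) \<Rightarrow> (complex \<Rightarrow> complex) \<Rightarrow> (complex \<Rightarrow> complex) \<Rightarrow> bool"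
  where "gen_chazy_system k S P Q R \<longleftrightarrow>
    (\<forall>x\<in>S.
      (P has_field_derivative 1/6 * (P x ^ 2 - Q x)) (at x within S) \<and>
      (Q has_field_derivative 2/3 * (P x * Q x - R x)) (at x within S) \<and>
      (R has_field_derivative P x * R x + k^2 / (36 - k^2) * Q x ^ 2) (at x within S))"

lemma gen_chazy_system_two_thirds:
  "gen_chazy_system (2/3) S P Q R \<longleftrightarrow>
    (\<forall>x\<in>S.
      (P has_field_derivative 1/6 * (P x ^ 2 - Q x)) (at x within S) \<and>
      (Q has_field_derivative 2/3 * (P x * Q x - R x)) (at x within S) \<and>
      (R has_field_derivative P x * R x + 1/80 * Q x ^ 2) (at x within S))"
proof -
  have "(2/3)^2 / (36 - (2/3)^2) = (1/80 :: complex)"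
    by (simp add: power2_eq_square)
  then show ?thesis
    unfolding gen_chazy_system_def by presburger
qed

definition differentiable_cube_root_on ::
    "complex set \<Rightarrow> (complex \<Rightarrow> complex) \<Rightarrow> (complex \<Rightarrow> complex) \<Rightarrow> bool"
  where "differentiable_cube_root_on S R C \<longleftrightarrow>
    (\<forall>x\<in>S. C field_differentiable (at x within S) \<and> C x ^ 3 = R x)"

definition cbrt10 :: complex
  where "cbrt10 = complex_of_real (root 3 10)"

definition omega :: complex
  where "omega = - 1/2 + \<i> * complex_of_real (sqrt 3) / 2"

end

theory Submission
  imports Defs
begin

text \<open>
  The system is homogeneous when \<open>P\<close>, \<open>Q\<close>, \<open>R\<close> carry the weights \<open>1\<close>, \<open>2\<close>, \<open>3\<close>.  Once a cube
  root \<open>D\<close> of \<open>R/10\<close> is chosen, put \<open>Q = 20 z D\<^sup>2\<close>; the function \<open>z\<close> of weight \<open>0\<close> then satisfies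
  \<open>z' = - D (z^3 + 1) / 3\<close>, and \<open>D' = P D / 3 + z\<^sup>2 D\<^sup>2 / 6\<close>
  (lemma \<open>chazy_cube_root_coordinates\<close>).

  Any four points of the Riemann sphere are permuted by a Klein four-group of Moebius maps.  For the
  zeros of \<open>z^3 + 1\<close> together with \<open>\<infinity>\<close>, one of its involutions is
  \<open>z \<mapsto> (2 - z) / (z + 1)\<close>, exchanging \<open>-1\<close> with \<open>\<infinity>\<close> and the two other zeros with each other.  It
  extends to a symmetry of the system in \<open>(P, D, z)\<close>, namely
  \<open>D \<mapsto> - D (z + 1)\<^sup>2 / 3\<close> and \<open>P \<mapsto> P - 4/3 D (z\<^sup>2 - z + 1)\<close>.  In the quantities
  \<open>20 z D\<^sup>2\<close> and \<open>10 D^3\<close> the denominator \<open>z + 1\<close> cancels, which gives a polynomial symmetry that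
  makes sense also where \<open>z = -1\<close> (lemma \<open>chazy_involution\<close>).

  The function \<open>\<mu>\<close> is \<open>- D (z - 2)\<^sup>2 / 6\<close>, and the triple in the theorem is the image of this symmetry
  (lemma \<open>mu_triple_eq_involution\<close>).  Replacing \<open>D\<close> by \<open>\<omega> D\<close> multiplies \<open>z\<close> by \<open>\<omega>\<close> and conjugates the
  involution into another one of the Klein group; hence the three versions of \<open>\<mu>\<close> correspond to the
  three choices \<open>t\<close> of a cube root of \<open>10\<close> in \<open>D = R^(1/3) / t\<close>.
\<close>

text \<open>
  An isolated point of \<open>S\<close> imposes no condition, since there every number is a derivative within
  \<open>S\<close>; elsewhere derivatives within \<open>S\<close> are unique and \<open>C' = R' / (3 C\<^sup>2)\<close> follows by
  differentiating \<open>C^3 = R\<close>.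
\<close>
lemma differentiable_cube_root_derivative:
  assumes C: "differentiable_cube_root_on S R C"
    and R: "(R has_field_derivative R') (at x within S)"
    and x: "x \<in> S" and nz: "R x \<noteq> 0"
  shows "(C has_field_derivative R' / (3 * C x ^ 2)) (at x within S)"
proof (cases "at x within S = bot")
  case True
  then show ?thesis
    by (simp add: has_field_derivative_def has_derivative_def bounded_linear_mult_right)
next
  case False
  obtain C' where C': "(C has_field_derivative C') (at x within S)"
    using C x unfolding differentiable_cube_root_on_def field_differentiable_def by blast
  have cube: "\<And>y. y \<in> S \<Longrightarrow> C y ^ 3 = R y"
    using C unfolding differentiable_cube_root_on_def by blast
  have "((\<lambda>y. C y ^ 3) has_field_derivative 3 * C x ^ 2 * C') (at x within S)"
    by (rule derivative_eq_intros C' refl | simp)+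
  moreover have "((\<lambda>y. C y ^ 3) has_field_derivative R') (at x within S)"
    by (rule has_field_derivative_transform_within[OF R zero_less_one x]) (simp add: cube)
  ultimately have "R' = 3 * C x ^ 2 * C'"
    using False has_field_derivative_unique by blast
  moreover have "C x \<noteq> 0"
    using cube[OF x] nz by auto
  ultimately show ?thesis
    using C' by simp
qed

lemma gen_chazy_system_cong:
  assumes sys: "gen_chazy_system k S P Q R"
    and eq: "\<And>x. x \<in> S \<Longrightarrow> P1 x = P x" "\<And>x. x \<in> S \<Longrightarrow> Q1 x = Q x" "\<And>x. x \<in> S \<Longrightarrow> R1 x = R x"
  shows "gen_chazy_system k S P1 Q1 R1"
  unfolding gen_chazy_system_def
proof (intro ballI)
  fix x assume x: "x \<in> S"
  have "(P has_field_derivative 1/6 * (P1 x ^ 2 - Q1 x)) (at x within S)"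
    and "(Q has_field_derivative 2/3 * (P1 x * Q1 x - R1 x)) (at x within S)"
    and "(R has_field_derivative P1 x * R1 x + k^2 / (36 - k^2) * Q1 x ^ 2) (at x within S)"
    using sys x unfolding gen_chazy_system_def eq[OF x] by blast+
  then show "(P1 has_field_derivative 1/6 * (P1 x ^ 2 - Q1 x)) (at x within S) \<and>
      (Q1 has_field_derivative 2/3 * (P1 x * Q1 x - R1 x)) (at x within S) \<and>
      (R1 has_field_derivative P1 x * R1 x + k^2 / (36 - k^2) * Q1 x ^ 2) (at x within S)"
    using has_field_derivative_transform_within[OF _ zero_less_one x] eq by metis
qed

definition chazy_coordinate_system ::
    "complex set \<Rightarrow> (complex \<Rightarrow> complex) \<Rightarrow> (complex \<Rightarrow> complex) \<Rightarrow> (complex \<Rightarrow> complex) \<Rightarrow> bool"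
  where "chazy_coordinate_system S P D z \<longleftrightarrow>
    (\<forall>x\<in>S.
      (P has_field_derivative 1/6 * (P x ^ 2 - 20 * z x * D x ^ 2)) (at x within S) \<and>
      (D has_field_derivative 1/3 * P x * D x + 1/6 * z x ^ 2 * D x ^ 2) (at x within S) \<and>
      (z has_field_derivative - 1/3 * D x * (z x ^ 3 + 1)) (at x within S))"

text \<open>
  The derivative of \<open>z\<close> has no term in \<open>P\<close>: such terms only reflect the weight of a quantity, and \<open>z\<close>
  has weight \<open>0\<close>.
\<close>
lemma chazy_cube_root_coordinates:
  fixes P Q R D :: "complex \<Rightarrow> complex"
  assumes sys: "gen_chazy_system (2/3) S P Q R"
    and nz: "\<And>x. x \<in> S \<Longrightarrow> R x \<noteq> 0"
    and cube: "\<And>x. x \<in> S \<Longrightarrow> R x = 10 * D x ^ 3"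
    and D: "\<And>x. x \<in> S \<Longrightarrow> (D has_field_derivative
              (P x * R x + 1/80 * Q x ^ 2) / (30 * D x ^ 2)) (at x within S)"
  shows "chazy_coordinate_system S P D (\<lambda>x. Q x / (20 * D x ^ 2))"
  unfolding chazy_coordinate_system_def
proof (intro ballI conjI)
  fix x assume x: "x \<in> S"
  have D0: "D x \<noteq> 0"
    using nz[OF x] cube[OF x] by auto
  have P': "(P has_field_derivative 1/6 * (P x ^ 2 - Q x)) (at x within S)"
    and Q': "(Q has_field_derivative 2/3 * (P x * Q x - R x)) (at x within S)"
    using sys x unfolding gen_chazy_system_two_thirds by blast+
  show "(P has_field_derivative
      1/6 * (P x ^ 2 - 20 * (Q x / (20 * D x ^ 2)) * D x ^ 2)) (at x within S)"
    using P' D0 by simp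
  have D': "(D has_field_derivative 1/3 * P x * D x + 1/6 * (Q x / (20 * D x ^ 2)) ^ 2 * D x ^ 2)
      (at x within S)"
    by (rule DERIV_cong[OF D[OF x]])
      (use D0 in \<open>simp add: cube[OF x] field_simps power2_eq_square power3_eq_cube\<close>)
  then show "(D has_field_derivative
      1/3 * P x * D x + 1/6 * (Q x / (20 * D x ^ 2)) ^ 2 * D x ^ 2) (at x within S)" .
  show "((\<lambda>x. Q x / (20 * D x ^ 2)) has_field_derivative
      - 1/3 * D x * ((Q x / (20 * D x ^ 2)) ^ 3 + 1)) (at x within S)"
    apply (rule derivative_eq_intros Q' D' refl | simp add: D0)+
    apply (use D0 in \<open>simp add: cube[OF x] divide_simps\<close>)
    apply (use D0 in algebra)
    done
qed

text \<open>
  With \<open>D1 = - D (z + 1)\<^sup>2 / 3\<close> and \<open>z1 = (2 - z) / (z + 1)\<close>, the second and third function are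
  \<open>20 z1 D1\<^sup>2\<close> and \<open>10 D1^3\<close> with the denominators cancelled.
\<close>
lemma chazy_involution:
  assumes sys: "chazy_coordinate_system S P D z"
  shows "gen_chazy_system (2/3) S
    (\<lambda>x. P x - 4/3 * D x * (z x ^ 2 - z x + 1))
    (\<lambda>x. 20/9 * D x ^ 2 * (2 - z x) * (z x + 1) ^ 3)
    (\<lambda>x. - 10/27 * D x ^ 3 * (z x + 1) ^ 6)"
  unfolding gen_chazy_system_two_thirds
proof (intro ballI conjI)
  fix x assume x: "x \<in> S"
  have der: "(P has_field_derivative 1/6 * (P x ^ 2 - 20 * z x * D x ^ 2)) (at x within S)"
    "(D has_field_derivative 1/3 * P x * D x + 1/6 * z x ^ 2 * D x ^ 2) (at x within S)"
    "(z has_field_derivative - 1/3 * D x * (z x ^ 3 + 1)) (at x within S)"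
    using sys x unfolding chazy_coordinate_system_def by blast+
  let ?p = "P x - 4/3 * D x * (z x ^ 2 - z x + 1)"
  let ?q = "20/9 * D x ^ 2 * (2 - z x) * (z x + 1) ^ 3"
  let ?r = "- 10/27 * D x ^ 3 * (z x + 1) ^ 6"
  show "((\<lambda>x. P x - 4/3 * D x * (z x ^ 2 - z x + 1)) has_field_derivative
      1/6 * (?p ^ 2 - ?q)) (at x within S)"
    apply (rule derivative_eq_intros der refl | simp)+
    apply (simp add: field_simps)
    apply algebra
    done
  show "((\<lambda>x. 20/9 * D x ^ 2 * (2 - z x) * (z x + 1) ^ 3) has_field_derivative
      2/3 * (?p * ?q - ?r)) (at x within S)"
    apply (rule derivative_eq_intros der refl | simp)+
    apply (simp add: field_simps)
    apply algebra
    done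
  show "((\<lambda>x. - 10/27 * D x ^ 3 * (z x + 1) ^ 6) has_field_derivative
      ?p * ?r + 1/80 * ?q ^ 2) (at x within S)"
    apply (rule derivative_eq_intros der refl | simp)+
    apply (simp add: field_simps)
    apply algebra
    done
qed

text \<open>
  In terms of \<open>z\<close> the three summands of \<open>\<mu>\<close> are \<open>- D z\<^sup>2 / 6\<close>, \<open>2 D z / 3\<close> and \<open>- 2 D / 3\<close>, so \<open>\<mu>\<close> is a
  multiple of the square \<open>(z - 2)\<^sup>2\<close>; this makes the three components factor.
\<close>
lemma mu_triple_eq_involution:
  fixes P Q R D \<mu> :: complex
  assumes D: "D \<noteq> 0" and R: "R = 10 * D ^ 3"
    and \<mu>: "\<mu> = - 1/240 * (Q ^ 2 / R) + Q / (30 * D) - 2/3 * D"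
  defines "z \<equiv> Q / (20 * D ^ 2)"
  shows "P - 1/40 * (Q ^ 2 / R) + 2 * \<mu> = P - 4/3 * D * (z ^ 2 - z + 1)"
    and "Q - Q ^ 4 / (640 * R ^ 2) + 10 * \<mu> ^ 2 = 20/9 * D ^ 2 * (2 - z) * (z + 1) ^ 3"
    and "R - Q ^ 3 / (32 * R) - 1/51200 * (Q ^ 6 / R ^ 3)
        + 5/2 * Q * \<mu> - 25/6400 * (Q ^ 4 / R ^ 2) * \<mu> + 35 * \<mu> ^ 3
      = - 10/27 * D ^ 3 * (z + 1) ^ 6"
proof -
  have Q: "Q = 20 * z * D ^ 2"
    using D by (simp add: z_def)
  have quotients: "Q ^ 2 / R = 40 * D * z ^ 2" "Q ^ 3 / (32 * R) = 25 * D ^ 3 * z ^ 3"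
    "Q ^ 4 / (640 * R ^ 2) = 5/2 * D ^ 2 * z ^ 4" "Q ^ 4 / R ^ 2 = 1600 * D ^ 2 * z ^ 4"
    "Q ^ 6 / R ^ 3 = 64000 * D ^ 3 * z ^ 6" "Q / (30 * D) = 2/3 * D * z"
    unfolding Q R using D
    by (simp_all add: field_simps power_numeral_reduce)
  have \<mu>': "\<mu> = - 1/6 * D * (z - 2) ^ 2"
    unfolding \<mu> quotients by (simp add: power2_eq_square field_simps)
  show "P - 1/40 * (Q ^ 2 / R) + 2 * \<mu> = P - 4/3 * D * (z ^ 2 - z + 1)"
    unfolding quotients \<mu>' by (simp add: power2_eq_square field_simps)
  show "Q - Q ^ 4 / (640 * R ^ 2) + 10 * \<mu> ^ 2 = 20/9 * D ^ 2 * (2 - z) * (z + 1) ^ 3"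
    unfolding quotients \<mu>' unfolding Q by (simp add: field_simps) algebra
  show "R - Q ^ 3 / (32 * R) - 1/51200 * (Q ^ 6 / R ^ 3)
        + 5/2 * Q * \<mu> - 25/6400 * (Q ^ 4 / R ^ 2) * \<mu> + 35 * \<mu> ^ 3
      = - 10/27 * D ^ 3 * (z + 1) ^ 6"
    unfolding quotients \<mu>' unfolding Q R by (simp add: field_simps) algebra
qed

lemma cbrt10_cubed: "cbrt10 ^ 3 = 10"
proof -
  have "root 3 10 ^ 3 = (10::real)"
    by simp
  then show ?thesis
    unfolding cbrt10_def by (metis of_real_numeral of_real_power)
qed

lemma omega_cubed: "omega ^ 3 = 1"
  unfolding omega_def
  by (simp add: power3_eq_cube complex_eq_iff field_simps)

theorem corollary3p2p1:
  fixes S :: "complex set" and P Q R C \<mu> :: "complex \<Rightarrow> complex"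
  assumes system: "gen_chazy_system (2/3) S P Q R"
    and nonzero: "\<forall>x\<in>S. R x \<noteq> 0"
    and cube_root: "differentiable_cube_root_on S R C"
    and mu:
      "(\<forall>x\<in>S. \<mu> x = - 1/240 * (Q x ^ 2 / R x) + cbrt10 / 30 * (Q x / C x)
          - cbrt10 ^ 2 / 15 * C x)
       \<or> (\<forall>x\<in>S. \<mu> x = - 1/240 * (Q x ^ 2 / R x) + omega * (cbrt10 / 30) * (Q x / C x)
          - omega ^ 2 * (cbrt10 ^ 2 / 15) * C x)
       \<or> (\<forall>x\<in>S. \<mu> x = - 1/240 * (Q x ^ 2 / R x) + omega ^ 2 * (cbrt10 / 30) * (Q x / C x)
          - omega * (cbrt10 ^ 2 / 15) * C x)"
  shows "gen_chazy_system (2/3) S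
      (\<lambda>x. P x - 1/40 * (Q x ^ 2 / R x) + 2 * \<mu> x)
      (\<lambda>x. Q x - Q x ^ 4 / (640 * R x ^ 2) + 10 * \<mu> x ^ 2)
      (\<lambda>x. R x - Q x ^ 3 / (32 * R x) - 1/51200 * (Q x ^ 6 / R x ^ 3)
        + 5/2 * Q x * \<mu> x - 25/6400 * (Q x ^ 4 / R x ^ 2) * \<mu> x + 35 * \<mu> x ^ 3)"
proof -
  \<comment> \<open>The three cases differ only in the cube root \<open>t\<close> of \<open>10\<close>: \<open>cbrt10\<close>, \<open>\<omega> cbrt10\<close> or \<open>\<omega>\<^sup>2 cbrt10\<close>;
    in the last one \<open>t\<^sup>2 = \<omega>^4 cbrt10\<^sup>2 = \<omega> cbrt10\<^sup>2\<close>.\<close>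
  obtain t where t3: "t ^ 3 = 10"
    and \<mu>: "\<And>x. x \<in> S \<Longrightarrow>
      \<mu> x = - 1/240 * (Q x ^ 2 / R x) + t / 30 * (Q x / C x) - t ^ 2 / 15 * C x"
  proof -
    have "(omega * cbrt10) ^ 3 = 10" "(omega ^ 2 * cbrt10) ^ 3 = 10"
      using omega_cubed cbrt10_cubed by algebra+
    moreover have "(omega ^ 2 * cbrt10) ^ 2 = omega * cbrt10 ^ 2"
      using omega_cubed by algebra
    ultimately show thesis
      using mu that[of cbrt10] that[of "omega * cbrt10"] that[of "omega ^ 2 * cbrt10"]
        cbrt10_cubed
      by (auto simp: power_mult_distrib)
  qed
  then have t0: "t \<noteq> 0"
    by auto
  define D where "D = (\<lambda>x. C x / t)"
  have C_cube: "C x ^ 3 = R x" if "x \<in> S" for x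
    using cube_root that unfolding differentiable_cube_root_on_def by blast
  have R_D: "R x = 10 * D x ^ 3" if "x \<in> S" for x
    using C_cube[OF that] t3 by (simp add: D_def power_divide)
  have D0: "D x \<noteq> 0" if "x \<in> S" for x
    using R_D[OF that] nonzero that by auto
  have D': "(D has_field_derivative (P x * R x + 1/80 * Q x ^ 2) / (30 * D x ^ 2)) (at x within S)"
    if x: "x \<in> S" for x
  proof -
    have "(R has_field_derivative P x * R x + 1/80 * Q x ^ 2) (at x within S)"
      using system x unfolding gen_chazy_system_two_thirds by blast
    from differentiable_cube_root_derivative[OF cube_root this x] nonzero x
    have "(D has_field_derivative (P x * R x + 1/80 * Q x ^ 2) / (3 * C x ^ 2) / t)
        (at x within S)"
      unfolding D_def by (intro DERIV_cdivide) simp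
    moreover have "3 * C x ^ 2 * t = 30 * D x ^ 2"
      using t0 t3 unfolding D_def by (simp add: field_simps power2_eq_square power3_eq_cube)
    ultimately show ?thesis
      by simp
  qed
  have \<mu>_D: "\<mu> x = - 1/240 * (Q x ^ 2 / R x) + Q x / (30 * D x) - 2/3 * D x" if "x \<in> S" for x
  proof -
    have "C x = t * D x"
      using t0 by (simp add: D_def)
    moreover have "t ^ 2 / 15 * (t * D x) = t ^ 3 / 15 * D x"
      by (simp add: power2_eq_square power3_eq_cube)
    then have "t ^ 2 / 15 * (t * D x) = 2/3 * D x"
      unfolding t3 by simp
    ultimately show ?thesis
      using \<mu>[OF that] t0 by simp
  qed
  have "chazy_coordinate_system S P D (\<lambda>x. Q x / (20 * D x ^ 2))"
    using chazy_cube_root_coordinates[OF system] nonzero R_D D' by blast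
  from chazy_involution[OF this] show ?thesis
    by (rule gen_chazy_system_cong; intro mu_triple_eq_involution[OF D0 R_D \<mu>_D])
qed

end
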